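(* Let $x(t)=(x_1(t),\dots,x_n(t))$ be a solution of the RoPE spherical self-attention flow on $(\mathbb{S}^{d-1})^n$ (arbitrary fixed positions, frequencies, and finite $\beta\ge0$). Fix $w\in\mathbb{S}^{d-1}$ and define $$h_i(t)=\langle x_i(t),w\rangle,\qquad m_w(t)=\min_i h_i(t).$$ If $m_w(0)\ge0$, then $m_w(t)\ge m_w(0)\ge0$ for all $t\ge0$. Thus both the fixed closed hemisphere (the set of states with $\langle x_i,w\rangle\ge0$ for all $i$) and its interior (the set of states with $\langle x_i,w\rangle>0$ for all $i$) are forward invariant. (This conclusion alone does not imply consensus.)
   Context: Let $n\ge2$ and $d=2r$ with $r\ge1$. Token $i$ has a fixed position $p_i\in\mathbb{R}$ and state $x_i\in\mathbb{S}^{d-1}$. For real frequencies $\omega_1,\dots,\omega_r$, define the block rotation $R_p=\bigoplus_{\ell=1}^r\begin{pmatrix}\cos(\omega_\ell p)&-\sin(\omega_\ell p)\\ \sin(\omega_\ell p)&\cos(\omega_\ell p)\end{pmatrix}$. For finite $\beta\ge0$: $s_{ij}(x)=\langle R_{p_i}x_i,R_{p_j}x_j\rangle$, $W_{ij}(x)=e^{\beta s_{ij}(x)}$, $Z_i(x)=\sum_kW_{ik}(x)$, $A_{ij}(x)=W_{ij}(x)/Z_i(x)$. The flow is $\dot x_i=\sum_{j=1}^nA_{ij}(x)(x_j-\langle x_i,x_j\rangle x_i)$; it has a unique global solution for every initial state in $(\mathbb{S}^{d-1})^n$. *)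

theory Defs
  imports "HOL-Analysis.Analysis"
begin

text \<open>Coordinates of \<open>\<real>\<^sup>d\<close>, \<open>d = 2r\<close>, are indexed by pairs (block, position in block):
  the block index type \<open>'r\<close> has \<open>r \<ge> 1\<close> elements, so \<open>CARD('r \<times> 2) = 2r\<close>.
  Tokens are indexed by the finite type \<open>'n\<close>.\<close>

definition rotation_block :: "real \<Rightarrow> real^2^2" where
  "rotation_block \<theta> = vector [vector [cos \<theta>, - sin \<theta>], vector [sin \<theta>, cos \<theta>]]"

definition rope_matrix :: "('r::finite \<Rightarrow> real) \<Rightarrow> real \<Rightarrow> real^('r \<times> 2)^('r \<times> 2)" where
  "rope_matrix \<omega> q = (\<chi> a b. if fst a = fst b
      then rotation_block (\<omega> (fst a) * q) $ snd a $ snd b else 0)"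

definition rope_score ::
  "('n \<Rightarrow> real) \<Rightarrow> ('r::finite \<Rightarrow> real) \<Rightarrow> ('n \<Rightarrow> real^('r \<times> 2)) \<Rightarrow> 'n \<Rightarrow> 'n \<Rightarrow> real" where
  "rope_score p \<omega> y i j = (rope_matrix \<omega> (p i) *v y i) \<bullet> (rope_matrix \<omega> (p j) *v y j)"

definition rope_weight ::
  "('n \<Rightarrow> real) \<Rightarrow> ('r::finite \<Rightarrow> real) \<Rightarrow> real \<Rightarrow> ('n \<Rightarrow> real^('r \<times> 2)) \<Rightarrow> 'n \<Rightarrow> 'n \<Rightarrow> real" where
  "rope_weight p \<omega> \<beta> y i j = exp (\<beta> * rope_score p \<omega> y i j)"

definition rope_attention ::
  "('n::finite \<Rightarrow> real) \<Rightarrow> ('r::finite \<Rightarrow> real) \<Rightarrow> real \<Rightarrow> ('n \<Rightarrow> real^('r \<times> 2)) \<Rightarrow> 'n \<Rightarrow> 'n \<Rightarrow> real" where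
  "rope_attention p \<omega> \<beta> y i j = rope_weight p \<omega> \<beta> y i j / (\<Sum>k\<in>UNIV. rope_weight p \<omega> \<beta> y i k)"

definition rope_velocity ::
  "('n::finite \<Rightarrow> real) \<Rightarrow> ('r::finite \<Rightarrow> real) \<Rightarrow> real \<Rightarrow> ('n \<Rightarrow> real^('r \<times> 2)) \<Rightarrow> 'n \<Rightarrow> real^('r \<times> 2)" where
  "rope_velocity p \<omega> \<beta> y i =
     (\<Sum>j\<in>UNIV. rope_attention p \<omega> \<beta> y i j *\<^sub>R (y j - (y i \<bullet> y j) *\<^sub>R y i))"

text \<open>Only the restriction of \<open>x\<close> to \<open>t \<ge> 0\<close> matters; the derivative at \<open>0\<close> is one-sided.\<close>

definition rope_solution ::
  "('n::finite \<Rightarrow> real) \<Rightarrow> ('r::finite \<Rightarrow> real) \<Rightarrow> real \<Rightarrow> (real \<Rightarrow> 'n \<Rightarrow> real^('r \<times> 2)) \<Rightarrow> bool" where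
  "rope_solution p \<omega> \<beta> x \<longleftrightarrow>
     (\<forall>t\<ge>0. \<forall>i. x t i \<in> sphere 0 1 \<and>
       ((\<lambda>s. x s i) has_vector_derivative rope_velocity p \<omega> \<beta> (x t) i) (at t within {0..}))"

definition rope_forward_invariant ::
  "('n::finite \<Rightarrow> real) \<Rightarrow> ('r::finite \<Rightarrow> real) \<Rightarrow> real \<Rightarrow> ('n \<Rightarrow> real^('r \<times> 2)) set \<Rightarrow> bool" where
  "rope_forward_invariant p \<omega> \<beta> K \<longleftrightarrow>
     (\<forall>x. rope_solution p \<omega> \<beta> x \<longrightarrow> x 0 \<in> K \<longrightarrow> (\<forall>t\<ge>0. x t \<in> K))"

definition min_height :: "'a::euclidean_space \<Rightarrow> ('n::finite \<Rightarrow> 'a) \<Rightarrow> real" where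
  "min_height w y = (MIN i. y i \<bullet> w)"

definition closed_hemisphere :: "'a::euclidean_space \<Rightarrow> ('n \<Rightarrow> 'a) set" where
  "closed_hemisphere w = {y. \<forall>i. y i \<in> sphere 0 1 \<and> y i \<bullet> w \<ge> 0}"

definition open_hemisphere :: "'a::euclidean_space \<Rightarrow> ('n \<Rightarrow> 'a) set" where
  "open_hemisphere w = {y. \<forall>i. y i \<in> sphere 0 1 \<and> y i \<bullet> w > 0}"

end

theory Submission imports Defs begin

text \<open>Write \<open>h i\<close> for the height of token \<open>i\<close> along \<open>w\<close>. Attention weights are positive and
  each row sums to one, so the flow makes each height move with speed
  \<open>\<Sum>j. A i j * (h j - c i j * h i)\<close>, where the cosines \<open>c i j\<close> of the angles between tokens lie
  in \<open>[-1, 1]\<close>. At a token of minimal height \<open>m\<close> every \<open>h j\<close> is at least \<open>m\<close>, so this speed is at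
  least \<open>m * (\<Sum>j. A i j * (1 - c i j)) = m * s\<close> with \<open>0 \<le> s \<le> 2\<close>
  (\<open>height_speed_ge_convex_factor\<close>). For \<open>m \<ge> 0\<close> the lowest token cannot descend.

  This differential inequality is not strict, and it is useful only while \<open>m \<ge> 0\<close>, which is part
  of what has to be shown. Both obstacles disappear when the heights are compared with the sinking
  barrier \<open>m\<^sub>0 - \<epsilon> * exp (3 * t)\<close>, where \<open>m\<^sub>0\<close> is the initial minimum: on first contact the token
  descends at rate at most \<open>2 * \<epsilon> * exp (3 * t)\<close>, strictly slower than the barrier, so it cannot
  have come from above (\<open>positive_of_no_first_contact\<close>). Letting \<open>\<epsilon>\<close> tend to zero gives the bound.\<close>

text \<open>Otherwise consider the first time \<open>T\<close> at which some component is not positive. By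
  continuity all components are nonnegative at \<open>T\<close> and one of them vanishes; its derivative
  there is positive, so it was already negative shortly before \<open>T\<close>.\<close>

lemma positive_of_no_first_contact:
  fixes v v' :: "'n::finite \<Rightarrow> real \<Rightarrow> real"
  assumes init: "\<And>i. v i 0 > 0"
    and deriv: "\<And>i t. t \<ge> 0 \<Longrightarrow> (v i has_real_derivative v' i t) (at t within {0..})"
    and contact: "\<And>i t. t \<ge> 0 \<Longrightarrow> v i t = 0 \<Longrightarrow> (\<And>j. v j t \<ge> 0) \<Longrightarrow> v' i t > 0"
    and "t \<ge> 0"
  shows "v i t > 0"
proof (rule ccontr)
  assume "\<not> v i t > 0"
  have cont: "continuous_on {0..} (v j)" for j
    by (rule DERIV_continuous_on) (use deriv in auto)
  define S where "S = (\<Union>j. {s \<in> {0..}. v j s \<le> 0})"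
  have "closed S"
    unfolding S_def
    by (intro closed_UN finite ballI continuous_on_closed_Collect_le cont continuous_on_const
        closed_atLeast)
  moreover have "t \<in> S"
    using \<open>\<not> v i t > 0\<close> \<open>t \<ge> 0\<close> by (auto simp: S_def not_less)
  moreover have bdd: "bdd_below S"
    by (auto simp: S_def intro!: bdd_belowI[of _ 0])
  ultimately have "Inf S \<in> S"
    by (intro closed_contains_Inf) auto
  define T where "T = Inf S"
  obtain k where k: "T \<ge> 0" "v k T \<le> 0"
    using \<open>Inf S \<in> S\<close> by (auto simp: S_def T_def)
  have "T > 0"
    using k init[of k] by (cases "T = 0") auto
  have before: "v j s > 0" if "0 \<le> s" "s < T" for j s
  proof (rule ccontr)
    assume "\<not> v j s > 0"
    then have "s \<in> S" using that by (auto simp: S_def not_less)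
    then show False using cInf_lower[OF _ bdd] that by (force simp: T_def)
  qed
  have nonneg: "v j T \<ge> 0" for j
  proof (rule continuous_ge_on_closure[where f = "v j" and x = T and S = "{0..<T}"])
    show "continuous_on (closure {0..<T}) (v j)"
      using \<open>T > 0\<close> by (intro continuous_on_subset[OF cont]) auto
    show "T \<in> closure {0..<T}" using \<open>T > 0\<close> by simp
    show "v j s \<ge> 0" if "s \<in> {0..<T}" for s using before[of s j] that by simp
  qed
  then have "v k T = 0" using k(2) by (simp add: antisym)
  then have "v' k T > 0" using contact k(1) nonneg by blast
  from has_real_derivative_pos_inc_left[OF deriv[OF k(1)] this]
  obtain d where d: "d > 0" "\<And>h. h > 0 \<Longrightarrow> T - h \<in> {0..} \<Longrightarrow> h < d \<Longrightarrow> v k (T - h) < v k T"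
    by blast
  define h where "h = min (d / 2) (T / 2)"
  have "0 < h" "h < d" "h < T" using d(1) \<open>T > 0\<close> by (auto simp: h_def)
  then show False
    using d(2)[of h] before[of "T - h" k] \<open>v k T = 0\<close> by simp
qed

lemma rope_attention_nonneg: "rope_attention p \<omega> \<beta> y i j \<ge> 0"
  unfolding rope_attention_def rope_weight_def by (intro divide_nonneg_nonneg sum_nonneg) auto

lemma rope_attention_sum: "(\<Sum>j\<in>UNIV. rope_attention p \<omega> \<beta> y i j) = 1"
proof -
  have "(\<Sum>k\<in>UNIV. rope_weight p \<omega> \<beta> y i k) > 0"
    by (intro sum_pos) (auto simp: rope_weight_def)
  then show ?thesis
    by (simp add: rope_attention_def flip: sum_divide_distrib)
qed

text \<open>The factor \<open>s\<close> is the attention average of \<open>1 - y i \<bullet> y j\<close>. It is nonnegative because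
  cosines are at most one, which is what makes a nonnegative lowest height nondecreasing; the
  bound \<open>2\<close> limits how fast a negative lowest height can sink.\<close>

lemma height_speed_ge_convex_factor:
  assumes sphere: "\<And>j. y j \<in> sphere 0 1"
    and lowest: "\<And>j. y i \<bullet> w \<le> y j \<bullet> w"
  obtains s where "0 \<le> s" "s \<le> 2" "rope_velocity p \<omega> \<beta> y i \<bullet> w \<ge> (y i \<bullet> w) * s"
proof
  let ?A = "rope_attention p \<omega> \<beta> y i"
  define s where "s = (\<Sum>j\<in>UNIV. ?A j * (1 - y i \<bullet> y j))"
  have cosine: "\<bar>y i \<bullet> y j\<bar> \<le> 1" for j
    using Cauchy_Schwarz_ineq2[of "y i" "y j"] sphere[of i] sphere[of j] by simp
  show "0 \<le> s"
    unfolding s_def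
    using cosine by (intro sum_nonneg mult_nonneg_nonneg rope_attention_nonneg) (simp add: abs_le_iff)
  have "s \<le> (\<Sum>j\<in>UNIV. ?A j * 2)"
    unfolding s_def
  proof (intro sum_mono mult_left_mono rope_attention_nonneg)
    show "1 - y i \<bullet> y j \<le> 2" for j using cosine[of j] by linarith
  qed
  also have "\<dots> = 2"
    by (simp add: rope_attention_sum flip: sum_distrib_right)
  finally show "s \<le> 2" .
  have "(y i \<bullet> w) * s = (\<Sum>j\<in>UNIV. ?A j * (y i \<bullet> w - (y i \<bullet> y j) * (y i \<bullet> w)))"
    unfolding s_def sum_distrib_left by (intro sum.cong) (auto simp: algebra_simps)
  also have "\<dots> \<le> (\<Sum>j\<in>UNIV. ?A j * (y j \<bullet> w - (y i \<bullet> y j) * (y i \<bullet> w)))"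
    using lowest by (intro sum_mono mult_left_mono rope_attention_nonneg) auto
  also have "\<dots> = rope_velocity p \<omega> \<beta> y i \<bullet> w"
    by (simp add: rope_velocity_def inner_sum_left inner_diff_left)
  finally show "rope_velocity p \<omega> \<beta> y i \<bullet> w \<ge> (y i \<bullet> w) * s" .
qed

text \<open>The rate \<open>3\<close> only has to exceed the bound \<open>2\<close> on the factor \<open>s\<close>. On contact the token is at
  height \<open>m - e\<close> with \<open>e = \<epsilon> * exp (3 * t)\<close>, so it descends at rate at most \<open>e * s \<le> 2 * e\<close>
  while the barrier descends at rate \<open>3 * e\<close>.\<close>

lemma height_above_barrier:
  assumes sol: "rope_solution p \<omega> \<beta> x"
    and init: "\<And>i. x 0 i \<bullet> w \<ge> m" and "m \<ge> 0"
    and "\<epsilon> > 0" and "t \<ge> 0"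
  shows "x t i \<bullet> w > m - \<epsilon> * exp (3 * t)"
proof -
  define v where "v = (\<lambda>i t. x t i \<bullet> w - (m - \<epsilon> * exp (3 * t)))"
  define v' where "v' = (\<lambda>i t. rope_velocity p \<omega> \<beta> (x t) i \<bullet> w + 3 * \<epsilon> * exp (3 * t))"
  have "v i t > 0"
  proof (rule positive_of_no_first_contact[where v = v and v' = v'])
    show "v i 0 > 0" for i
      using init[of i] \<open>\<epsilon> > 0\<close> by (simp add: v_def)
    show "(v i has_real_derivative v' i t) (at t within {0..})" if "t \<ge> 0" for i t
    proof -
      have "((\<lambda>s. x s i) has_vector_derivative rope_velocity p \<omega> \<beta> (x t) i) (at t within {0..})"
        using sol that by (simp add: rope_solution_def)
      then have "((\<lambda>s. x s i \<bullet> w) has_vector_derivative rope_velocity p \<omega> \<beta> (x t) i \<bullet> w)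
          (at t within {0..})"
        by (rule bounded_linear.has_vector_derivative[OF bounded_linear_inner_left])
      then have "((\<lambda>s. x s i \<bullet> w) has_real_derivative rope_velocity p \<omega> \<beta> (x t) i \<bullet> w)
          (at t within {0..})"
        by (simp add: has_real_derivative_iff_has_vector_derivative)
      note [derivative_intros] = this
      show ?thesis
        unfolding v_def v'_def by (auto intro!: derivative_eq_intros)
    qed
    show "v' i t > 0" if "t \<ge> 0" "v i t = 0" and nonneg: "\<And>j. v j t \<ge> 0" for i t
    proof -
      define e where "e = \<epsilon> * exp (3 * t)"
      have "e > 0" using \<open>\<epsilon> > 0\<close> by (simp add: e_def)
      have height: "x t i \<bullet> w = m - e" using that by (simp add: v_def e_def)
      have "x t i \<bullet> w \<le> x t j \<bullet> w" for j
        using nonneg[of j] height by (simp add: v_def e_def)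
      moreover have "x t j \<in> sphere 0 1" for j
        using sol \<open>t \<ge> 0\<close> by (simp add: rope_solution_def)
      ultimately obtain s where s: "0 \<le> s" "s \<le> 2"
          "rope_velocity p \<omega> \<beta> (x t) i \<bullet> w \<ge> (x t i \<bullet> w) * s"
        using height_speed_ge_convex_factor[of "x t" i w p \<omega> \<beta>] by metis
      have "(x t i \<bullet> w) * s \<ge> - e * s"
        using s(1) height \<open>m \<ge> 0\<close> by (intro mult_right_mono) auto
      moreover have "e * s \<le> e * 2" using s(2) \<open>e > 0\<close> by simp
      ultimately have "rope_velocity p \<omega> \<beta> (x t) i \<bullet> w + 3 * e > 0"
        using s(3) \<open>e > 0\<close> by linarith
      then show ?thesis by (simp add: v'_def e_def)
    qed
  qed (fact \<open>t \<ge> 0\<close>)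
  then show ?thesis by (simp add: v_def)
qed

lemma height_ge_initial_bound:
  assumes "rope_solution p \<omega> \<beta> x" and "\<And>i. x 0 i \<bullet> w \<ge> m" and "m \<ge> 0" and "t \<ge> 0"
  shows "x t i \<bullet> w \<ge> m"
proof (rule field_le_epsilon)
  fix e :: real assume "e > 0"
  \<comment> \<open>This choice of \<open>\<epsilon>\<close> puts the barrier at \<open>m - e\<close> at the given time \<open>t\<close>.\<close>
  with height_above_barrier[OF assms(1-3), of "e / exp (3 * t)" t i] assms(4)
  show "m \<le> x t i \<bullet> w + e" by simp
qed

lemma min_height_ge_iff: "min_height w y \<ge> c \<longleftrightarrow> (\<forall>i. y i \<bullet> w \<ge> c)"
  by (simp add: min_height_def)

lemma min_height_gt_iff: "min_height w y > c \<longleftrightarrow> (\<forall>i. y i \<bullet> w > c)"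
  by (simp add: min_height_def)

theorem proposition6p1:
  fixes p :: "'n::finite \<Rightarrow> real"
    and \<omega> :: "'r::finite \<Rightarrow> real"
    and \<beta> :: real
    and w :: "real^('r \<times> 2)"
  assumes "CARD('n) \<ge> 2"
    and "\<beta> \<ge> 0"
    and "w \<in> sphere 0 1"
  shows "(\<forall>x. rope_solution p \<omega> \<beta> x \<longrightarrow> min_height w (x 0) \<ge> 0 \<longrightarrow>
            (\<forall>t\<ge>0. min_height w (x t) \<ge> min_height w (x 0) \<and> min_height w (x 0) \<ge> 0))
       \<and> rope_forward_invariant p \<omega> \<beta> (closed_hemisphere w)
       \<and> rope_forward_invariant p \<omega> \<beta> (open_hemisphere w)"
proof -
  have monotone: "min_height w (x t) \<ge> min_height w (x 0)"
    if "rope_solution p \<omega> \<beta> x" "min_height w (x 0) \<ge> 0" "t \<ge> 0" for x t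
    unfolding min_height_ge_iff
    using height_ge_initial_bound[OF that(1) _ that(2,3)] min_height_ge_iff by blast
  have closed_iff: "y \<in> closed_hemisphere w \<longleftrightarrow> (\<forall>i. y i \<in> sphere 0 1) \<and> min_height w y \<ge> 0"
    and open_iff: "y \<in> open_hemisphere w \<longleftrightarrow> (\<forall>i. y i \<in> sphere 0 1) \<and> min_height w y > 0"
    for y :: "'n \<Rightarrow> real^('r \<times> 2)"
    by (auto simp: closed_hemisphere_def open_hemisphere_def min_height_ge_iff min_height_gt_iff)
  have on_sphere: "\<forall>i. x t i \<in> sphere 0 1" if "rope_solution p \<omega> \<beta> x" "t \<ge> 0" for x t
    using that by (simp add: rope_solution_def)
  have "rope_forward_invariant p \<omega> \<beta> (closed_hemisphere w)"
    unfolding rope_forward_invariant_def closed_iff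
    using monotone on_sphere by (meson order_trans)
  moreover have "rope_forward_invariant p \<omega> \<beta> (open_hemisphere w)"
    unfolding rope_forward_invariant_def open_iff
    using monotone on_sphere by (meson less_imp_le less_le_trans)
  ultimately show ?thesis
    using monotone by blast
qed

end
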